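(* Consider the convex problem $p^\star=\inf_{x\in\mathbb{R}^n}\{f_0(x): f_i(x)\le 0,\ i=1,\dots,m,\ Ax=b\}$ with an optimal solution $x^\star$. Assume that (i) the norms of the subgradients of $f_0,f_1,\dots,f_m$ and the values of $f_1,\dots,f_m$ are bounded on every compact subset of $\mathbb{R}^n$, and (ii) strong duality holds: $p^\star=d^\star$ and the dual problem $d^\star=\sup_{\lambda\in\mathbb{R}^m_+,\,\nu\in\mathbb{R}^l}\inf_{x\in\mathbb{R}^n}L(x,\lambda,\nu)$ has an optimal solution $(\lambda^\star,\nu^\star)$. Let $(\overline{x}^{(k)})_{k\ge 1}$ be the averaged points generated by the dual subgradient method (DSG), where $G(z^{(k)})\neq 0$ for all $k$. Then there is a constant $c>0$, independent of $\varepsilon$ and $K$, such that for every $\varepsilon>0$ and every integer $K\ge c\,\varepsilon^{-2}$, $$\|F(\overline{x}^{(K+1)})\|_2+\|A\overline{x}^{(K+1)}-b\|_2\le \varepsilon\qquad\text{and}\qquad f_0(\overline{x}^{(K+1)})\le p^\star+\varepsilon .$$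
   Context: Data: $f_0,f_1,\dots,f_m:\mathbb{R}^n\to\mathbb{R}$ are convex (possibly nondifferentiable), $A\in\mathbb{R}^{l\times n}$, $b\in\mathbb{R}^l$. An optimal solution $x^\star$ satisfies $f_i(x^\star)\le0$ for $i=1,\dots,m$, $Ax^\star=b$, $f_0(x^\star)=p^\star$. $F(x):=(F_1(x),\dots,F_m(x))$ with $F_i(x)=\max\{f_i(x),0\}$. Lagrangian: $L(x,\lambda,\nu)=f_0(x)+\lambda^\top F(x)+\nu^\top(Ax-b)$ for $x\in\mathbb{R}^n,\lambda\in\mathbb{R}^m_+,\nu\in\mathbb{R}^l$. $\partial$ denotes the convex subdifferential. Fix subgradient selections $g_0(x)\in\partial f_0(x)$ and $g_i(x)\in\partial F_i(x)$, $i=1,\dots,m$. For $z=(x,\lambda,\nu)$ put $G_x(z)=g_0(x)+\sum_{i=1}^m\lambda_i g_i(x)+A^\top\nu$ (an element of $\partial_xL(z)$), $G_\lambda(z)=F(x)$, $G_\nu(z)=Ax-b$, and $G(z)=(G_x(z),-G_\lambda(z),-G_\nu(z))$. DSG method: choose $z^{(0)}=(x^{(0)},\lambda^{(0)},\nu^{(0)})\in\mathbb{R}^n\times\mathbb{R}^m_+\times\mathbb{R}^l$ and set $s^{(0)}=0$, $\hat{x}^{(0)}=0$, $\delta_0=0$, $\beta_0=1$. For $k=0,1,2,\dots$, with $z^{(k)}=(x^{(k)},\lambda^{(k)},\nu^{(k)})$: 1. $s^{(k+1)}=s^{(k)}+G(z^{(k)})/\|G(z^{(k)})\|_2$; 2.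 $z^{(k+1)}=z^{(0)}-s^{(k+1)}/\beta_k$; 3. $\beta_{k+1}=\beta_k+1/\beta_k$; 4. $\delta_{k+1}=\delta_k+1/\|G(z^{(k)})\|_2$; 5. $\hat{x}^{(k+1)}=\hat{x}^{(k)}+x^{(k)}/\|G(z^{(k)})\|_2$; 6. $\overline{x}^{(k+1)}=\delta_{k+1}^{-1}\hat{x}^{(k+1)}$. *)

theory Defs
  imports "HOL-Analysis.Analysis"
begin

definition subdifferential :: "(real^'n \<Rightarrow> real) \<Rightarrow> real^'n \<Rightarrow> (real^'n) set"
  where "subdifferential h x = {g. \<forall>y. h y \<ge> h x + g \<bullet> (y - x)}"

definition feasible_set ::
    "('m::finite \<Rightarrow> real^'n \<Rightarrow> real) \<Rightarrow> real^'n^'l \<Rightarrow> real^'l \<Rightarrow> (real^'n) set"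
  where "feasible_set f A b = {x. (\<forall>i. f i x \<le> 0) \<and> A *v x = b}"

text \<open>The optimal values are extended reals, since the infimum defining the dual function
  may be \<open>-\<infinity>\<close>.\<close>

definition primal_value ::
    "(real^'n \<Rightarrow> real) \<Rightarrow> ('m::finite \<Rightarrow> real^'n \<Rightarrow> real) \<Rightarrow> real^'n^'l \<Rightarrow> real^'l \<Rightarrow> ereal"
  where "primal_value f0 f A b = (INF x\<in>feasible_set f A b. ereal (f0 x))"

definition primal_optimal ::
    "(real^'n \<Rightarrow> real) \<Rightarrow> ('m::finite \<Rightarrow> real^'n \<Rightarrow> real) \<Rightarrow> real^'n^'l \<Rightarrow> real^'l \<Rightarrow> real^'n \<Rightarrow> bool"
  where "primal_optimal f0 f A b x \<longleftrightarrow>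
    x \<in> feasible_set f A b \<and> ereal (f0 x) = primal_value f0 f A b"

definition F_vec :: "('m::finite \<Rightarrow> real^'n \<Rightarrow> real) \<Rightarrow> real^'n \<Rightarrow> real^'m"
  where "F_vec f x = (\<chi> i. max (f i x) 0)"

definition Lagrangian ::
    "(real^'n \<Rightarrow> real) \<Rightarrow> ('m::finite \<Rightarrow> real^'n \<Rightarrow> real) \<Rightarrow> real^'n^'l \<Rightarrow> real^'l
      \<Rightarrow> real^'n \<Rightarrow> real^'m \<Rightarrow> real^'l \<Rightarrow> real"
  where "Lagrangian f0 f A b x lam nu = f0 x + lam \<bullet> F_vec f x + nu \<bullet> (A *v x - b)"

definition nonneg_orthant :: "(real^'m) set"
  where "nonneg_orthant = {lam. \<forall>i. 0 \<le> lam $ i}"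

definition dual_function ::
    "(real^'n \<Rightarrow> real) \<Rightarrow> ('m::finite \<Rightarrow> real^'n \<Rightarrow> real) \<Rightarrow> real^'n^'l \<Rightarrow> real^'l
      \<Rightarrow> real^'m \<Rightarrow> real^'l \<Rightarrow> ereal"
  where "dual_function f0 f A b lam nu = (INF x. ereal (Lagrangian f0 f A b x lam nu))"

definition dual_value ::
    "(real^'n \<Rightarrow> real) \<Rightarrow> ('m::finite \<Rightarrow> real^'n \<Rightarrow> real) \<Rightarrow> real^'n^'l \<Rightarrow> real^'l \<Rightarrow> ereal"
  where "dual_value f0 f A b =
    (SUP (lam, nu)\<in>nonneg_orthant \<times> UNIV. dual_function f0 f A b lam nu)"

definition dual_optimal ::
    "(real^'n \<Rightarrow> real) \<Rightarrow> ('m::finite \<Rightarrow> real^'n \<Rightarrow> real) \<Rightarrow> real^'n^'l \<Rightarrow> real^'l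
      \<Rightarrow> real^'m \<Rightarrow> real^'l \<Rightarrow> bool"
  where "dual_optimal f0 f A b lam nu \<longleftrightarrow>
    lam \<in> nonneg_orthant \<and> dual_function f0 f A b lam nu = dual_value f0 f A b"

definition G_x ::
    "(real^'n \<Rightarrow> real^'n) \<Rightarrow> ('m::finite \<Rightarrow> real^'n \<Rightarrow> real^'n) \<Rightarrow> real^'n^'l
      \<Rightarrow> (real^'n) \<times> (real^'m) \<times> (real^'l) \<Rightarrow> real^'n"
  where "G_x g0 g A = (\<lambda>(x, lam, nu).
    g0 x + (\<Sum>i\<in>UNIV. (lam $ i) *\<^sub>R g i x) + transpose A *v nu)"

text \<open>The norm of the product type is the Euclidean norm of the concatenated vector.\<close>

definition G_map ::
    "('m::finite \<Rightarrow> real^'n \<Rightarrow> real) \<Rightarrow> real^'n^'l \<Rightarrow> real^'l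
      \<Rightarrow> (real^'n \<Rightarrow> real^'n) \<Rightarrow> ('m \<Rightarrow> real^'n \<Rightarrow> real^'n)
      \<Rightarrow> (real^'n) \<times> (real^'m) \<times> (real^'l) \<Rightarrow> (real^'n) \<times> (real^'m) \<times> (real^'l)"
  where "G_map f A b g0 g = (\<lambda>(x, lam, nu).
    (G_x g0 g A (x, lam, nu), - F_vec f x, - (A *v x - b)))"

text \<open>The recursion determines all the sequences from \<open>z 0\<close>, except for the irrelevant
  value \<open>xbar 0\<close>.\<close>

definition DSG_sequence ::
    "((real^'n) \<times> (real^'m) \<times> (real^'l) \<Rightarrow> (real^'n) \<times> (real^'m) \<times> (real^'l))
      \<Rightarrow> (nat \<Rightarrow> (real^'n) \<times> (real^'m) \<times> (real^'l)) \<Rightarrow> (nat \<Rightarrow> (real^'n) \<times> (real^'m) \<times> (real^'l))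
      \<Rightarrow> (nat \<Rightarrow> real) \<Rightarrow> (nat \<Rightarrow> real) \<Rightarrow> (nat \<Rightarrow> real^'n) \<Rightarrow> (nat \<Rightarrow> real^'n) \<Rightarrow> bool"
  where "DSG_sequence G z s \<beta> \<delta> xhat xbar \<longleftrightarrow>
    fst (snd (z 0)) \<in> nonneg_orthant \<and>
    s 0 = 0 \<and> xhat 0 = 0 \<and> \<delta> 0 = 0 \<and> \<beta> 0 = 1 \<and>
    (\<forall>k. s (Suc k) = s k + G (z k) /\<^sub>R norm (G (z k)) \<and>
         z (Suc k) = z 0 - s (Suc k) /\<^sub>R \<beta> k \<and>
         \<beta> (Suc k) = \<beta> k + 1 / \<beta> k \<and>
         \<delta> (Suc k) = \<delta> k + 1 / norm (G (z k)) \<and>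
         xhat (Suc k) = xhat k + fst (z k) /\<^sub>R norm (G (z k)) \<and>
         xbar (Suc k) = xhat (Suc k) /\<^sub>R \<delta> (Suc k))"

end

theory Submission
  imports Defs
begin

text \<open>The iteration is dual averaging with unit steps for the monotone map \<open>G\<close>. Its standard
  potential argument bounds \<open>(\<Sum>i\<le>k. (G (z i) \<bullet> (z i - w)) / norm (G (z i)))\<close> by
  \<open>\<beta> k / 2 * (1 + norm (z 0 - w)\<^sup>2 - norm (z (k + 1) - w)\<^sup>2)\<close> for every \<open>w\<close>. For \<open>w = z\<^sup>*\<close> the sum is
  nonnegative, so the iterates stay in a ball around \<open>z\<^sup>*\<close>, where \<open>G\<close> is bounded by some \<open>M\<close>.
  Hence \<open>\<delta> (K + 1) \<ge> (K + 1) / M\<close> while \<open>\<beta> K = O(\<surd>K)\<close>, and by Jensen's inequality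
  \<open>L(xbar, \<lambda>, \<nu>) - p\<^sup>*\<close> is \<open>O(1 / \<surd>K)\<close>, uniformly for bounded multipliers. The multipliers
  \<open>\<lambda> = 0\<close>, \<open>\<nu> = 0\<close> give the bound on the objective; moving from \<open>(\<lambda>\<^sup>*, \<nu>\<^sup>*)\<close> by a unit step along each
  residual gives the bound on the infeasibility.\<close>

section \<open>Growth of the scaling parameters and the dual averaging bound\<close>

lemma beta_sequence_ge_1:
  fixes \<beta> :: "nat \<Rightarrow> real"
  assumes "\<beta> 0 = 1" and "\<And>k. \<beta> (Suc k) = \<beta> k + 1 / \<beta> k"
  shows "\<beta> k \<ge> 1"
  by (induction k) (auto simp: assms add_increasing2)

text \<open>Squaring the recursion adds \<open>2 + (1 / \<beta> k)\<^sup>2\<close> to the square, at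
  most 3 because \<open>\<beta> k\<close> is at least 1.\<close>

lemma beta_sequence_sqrt_bound:
  fixes \<beta> :: "nat \<Rightarrow> real"
  assumes "\<beta> 0 = 1" and "\<And>k. \<beta> (Suc k) = \<beta> k + 1 / \<beta> k"
  shows "\<beta> k \<le> sqrt (3 * real (Suc k))"
proof -
  have "(\<beta> k)\<^sup>2 \<le> 3 * real (Suc k)"
  proof (induction k)
    case 0
    then show ?case by (simp add: assms)
  next
    case (Suc k)
    have b: "\<beta> k \<ge> 1" using beta_sequence_ge_1[OF assms] .
    have "(\<beta> (Suc k))\<^sup>2 = (\<beta> k)\<^sup>2 + 2 + (1 / \<beta> k)\<^sup>2"
      using b unfolding assms(2) by (simp add: power2_sum)
    moreover have "(1 / \<beta> k)\<^sup>2 \<le> 1"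
      using b by (intro power_le_one) auto
    ultimately show ?case using Suc by simp
  qed
  then show ?thesis by (rule real_le_rsqrt)
qed

text \<open>The directions \<open>u k\<close> may be any unit vectors, so this is pure algebra. The
  squared distance to \<open>w\<close> is kept on the left because it confines the iterates once the
  sum is known to be nonnegative.\<close>

lemma dual_averaging_regret:
  fixes z s u :: "nat \<Rightarrow> 'a::real_inner" and \<beta> :: "nat \<Rightarrow> real"
  assumes s0: "s 0 = 0"
    and s_Suc: "\<And>k. s (Suc k) = s k + u k"
    and u: "\<And>k. norm (u k) = 1"
    and z_Suc: "\<And>k. z (Suc k) = z 0 - s (Suc k) /\<^sub>R \<beta> k"
    and \<beta>0: "\<beta> 0 = 1"
    and \<beta>_Suc: "\<And>k. \<beta> (Suc k) = \<beta> k + 1 / \<beta> k"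
  shows "(\<Sum>i\<le>k. u i \<bullet> (z i - w)) + \<beta> k / 2 * (norm (z (Suc k) - w))\<^sup>2
    \<le> \<beta> k / 2 * (1 + (norm (z 0 - w))\<^sup>2)"
proof -
  have \<beta>1: "\<beta> k \<ge> 1" for k
    using beta_sequence_ge_1[OF \<beta>0 \<beta>_Suc] .
  \<comment> \<open>This is the case \<open>w = z 0\<close>. In the induction step the cross term of
    the expanded square cancels the new summand; what remains, \<open>1 / (2 * \<beta> k)\<close>,
    is exactly the growth of \<open>\<beta> k / 2\<close>.\<close>
  have potential: "(\<Sum>i\<le>k. u i \<bullet> (z i - z 0)) + (norm (s (Suc k)))\<^sup>2 / (2 * \<beta> k) \<le> \<beta> k / 2" for k
  proof (induction k)
    case 0
    then show ?case by (simp add: s0 s_Suc u \<beta>0)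
  next
    case (Suc k)
    have b: "\<beta> k > 0" using \<beta>1[of k] by linarith
    have "(norm (s (Suc (Suc k))))\<^sup>2 = (norm (s (Suc k)))\<^sup>2 + 2 * (u (Suc k) \<bullet> s (Suc k)) + 1"
      using u[of "Suc k"]
      by (simp add: s_Suc[of "Suc k"] power2_norm_eq_inner inner_add_left inner_add_right
          inner_commute norm_eq_1)
    then have "(norm (s (Suc (Suc k))))\<^sup>2 / (2 * \<beta> k)
        = (norm (s (Suc k)))\<^sup>2 / (2 * \<beta> k) + (u (Suc k) \<bullet> s (Suc k)) / \<beta> k + 1 / (2 * \<beta> k)"
      using b by (simp add: field_simps)
    moreover have "u (Suc k) \<bullet> (z (Suc k) - z 0) = - (u (Suc k) \<bullet> s (Suc k)) / \<beta> k"
      using b by (simp add: z_Suc divide_inverse)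
    moreover have "(norm (s (Suc (Suc k))))\<^sup>2 / (2 * \<beta> (Suc k)) \<le> (norm (s (Suc (Suc k))))\<^sup>2 / (2 * \<beta> k)"
      using b by (intro divide_left_mono) (auto simp: \<beta>_Suc add_pos_pos)
    moreover have "\<beta> (Suc k) / 2 = \<beta> k / 2 + 1 / (2 * \<beta> k)"
      by (simp add: \<beta>_Suc add_divide_distrib)
    ultimately show ?case using Suc unfolding sum.atMost_Suc by linarith
  qed
  have b: "\<beta> k > 0" using \<beta>1[of k] by linarith
  have s_sum: "s (Suc k) = (\<Sum>i\<le>k. u i)" for k
    by (induction k) (simp_all add: s0 s_Suc)
  have s_z: "s (Suc k) = \<beta> k *\<^sub>R (z 0 - z (Suc k))"
    using b by (simp add: z_Suc)
  have "(\<Sum>i\<le>k. u i \<bullet> (z i - w)) = (\<Sum>i\<le>k. u i \<bullet> (z i - z 0)) + s (Suc k) \<bullet> (z 0 - w)"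
    by (simp add: s_sum inner_sum_left inner_diff_right sum.distrib sum_subtractf)
  also have "\<dots> \<le> \<beta> k / 2 - (norm (s (Suc k)))\<^sup>2 / (2 * \<beta> k) + s (Suc k) \<bullet> (z 0 - w)"
    using potential[of k] by simp
  also have "(norm (s (Suc k)))\<^sup>2 / (2 * \<beta> k) = \<beta> k / 2 * (norm (z 0 - z (Suc k)))\<^sup>2"
    using b unfolding s_z by (simp add: power_mult_distrib power2_eq_square)
  \<comment> \<open>As \<open>s (Suc k)\<close> is a multiple of \<open>z 0 - z (Suc k)\<close>,
    polarization yields squared distances; the first of them cancels the term from
    \<open>norm (s (Suc k))\<close>.\<close>
  also have "s (Suc k) \<bullet> (z 0 - w) = \<beta> k / 2 *
      ((norm (z 0 - z (Suc k)))\<^sup>2 + (norm (z 0 - w))\<^sup>2 - (norm (z (Suc k) - w))\<^sup>2)"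
  proof -
    have "(norm (z (Suc k) - w))\<^sup>2 = (norm ((z 0 - w) - (z 0 - z (Suc k))))\<^sup>2"
      by simp
    also have "\<dots> = (norm (z 0 - w))\<^sup>2 - 2 * ((z 0 - z (Suc k)) \<bullet> (z 0 - w))
        + (norm (z 0 - z (Suc k)))\<^sup>2"
      by (simp only: power2_norm_eq_inner inner_diff_left inner_diff_right) (simp add: inner_commute)
    finally show ?thesis unfolding s_z inner_scaleR_left by simp
  qed
  finally show ?thesis by (simp add: algebra_simps)
qed

section \<open>The Lagrangian: convexity and subgradient inequality\<close>

lemma F_vec_nonneg: "0 \<le> F_vec f x $ i"
  by (simp add: F_vec_def)

lemma Lagrangian_at_feasible:
  assumes "x \<in> feasible_set f A b"
  shows "Lagrangian f0 f A b x lam nu = f0 x"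
proof -
  have "F_vec f x = 0"
    using assms by (auto simp: F_vec_def feasible_set_def vec_eq_iff max_def)
  then show ?thesis using assms by (simp add: Lagrangian_def feasible_set_def)
qed

text \<open>Positive parts of convex functions are convex, nonnegative weights preserve this, and
  the equality term is affine. Jensen's inequality for the averaged points rests on it.\<close>

lemma convex_on_Lagrangian:
  assumes "convex_on UNIV f0" "\<And>i. convex_on UNIV (f i)" "lam \<in> nonneg_orthant"
  shows "convex_on UNIV (\<lambda>x. Lagrangian f0 f A b x lam nu)"
proof -
  have F: "convex_on UNIV (\<lambda>x. F_vec f x $ i)" for i
    unfolding convex_on_def
  proof (intro conjI ballI allI impI convex_UNIV)
    fix x y and u v :: real
    assume uv: "0 \<le> u" "0 \<le> v" "u + v = 1"
    then have "f i (u *\<^sub>R x + v *\<^sub>R y) \<le> u * f i x + v * f i y"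
      using assms(2)[of i] unfolding convex_on_def by blast
    also have "\<dots> \<le> u * F_vec f x $ i + v * F_vec f y $ i"
      using uv by (intro add_mono mult_left_mono) (auto simp: F_vec_def)
    finally show "F_vec f (u *\<^sub>R x + v *\<^sub>R y) $ i \<le> u * F_vec f x $ i + v * F_vec f y $ i"
      using uv by (simp add: F_vec_def)
  qed
  have "convex_on UNIV (\<lambda>x. \<Sum>i\<in>I. lam $ i * F_vec f x $ i)" if "finite I" for I
    using that
  proof induction
    case (insert i I)
    then show ?case
      using assms(3) by (simp add: convex_on_add convex_on_cmul F nonneg_orthant_def)
  qed (simp add: convex_on_const)
  moreover have "convex_on UNIV (\<lambda>x. nu \<bullet> (A *v x - b))"
    by (rule convex_onI)
      (auto simp: matrix_vector_right_distrib matrix_vector_mult_scaleR algebra_simps)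
  ultimately show ?thesis
    unfolding Lagrangian_def inner_vec_def inner_real_def by (intro convex_on_add assms(1)) simp_all
qed

text \<open>Insert \<open>Lagrangian f0 f A b x lam nu\<close> between the two values. The change of
  point is bounded by the subgradient inequality, where \<open>lam\<close> must be nonnegative; the
  change of multipliers is exact by affinity and accounts for the minus signs in
  \<open>G_map\<close>.\<close>

lemma Lagrangian_gap_le_G_map_inner:
  assumes g0: "g0 x \<in> subdifferential f0 x"
    and g: "\<And>i. g i x \<in> subdifferential (\<lambda>y. F_vec f y $ i) x"
    and lam: "lam \<in> nonneg_orthant"
  shows "Lagrangian f0 f A b x lam' nu' - Lagrangian f0 f A b x' lam nu
    \<le> G_map f A b g0 g (x, lam, nu) \<bullet> ((x, lam, nu) - (x', lam', nu'))"
proof -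
  have "f0 x' \<ge> f0 x + g0 x \<bullet> (x' - x)"
    using g0 by (simp add: subdifferential_def)
  moreover have "lam \<bullet> F_vec f x' \<ge> lam \<bullet> F_vec f x + (\<Sum>i\<in>UNIV. lam $ i *\<^sub>R g i x) \<bullet> (x' - x)"
  proof -
    have "lam $ i * F_vec f x' $ i \<ge> lam $ i * (F_vec f x $ i + g i x \<bullet> (x' - x))" for i
      using g[of i] lam by (intro mult_left_mono) (auto simp: subdifferential_def nonneg_orthant_def)
    then show ?thesis
      by (simp add: inner_vec_def[where x = lam] inner_sum_left sum.distrib[symmetric]
          distrib_left[symmetric] sum_mono del: sum.distrib)
  qed
  moreover have "(transpose A *v nu) \<bullet> (x - x') = nu \<bullet> (A *v x) - nu \<bullet> (A *v x')"
    by (simp add: dot_lmul_matrix[symmetric] transpose_matrix_vector inner_diff_right)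
  ultimately show ?thesis
    by (simp add: Lagrangian_def G_map_def G_x_def inner_add_left inner_diff_left inner_diff_right
        inner_add_right inner_commute)
qed

text \<open>Moving from \<open>x\<close> by a unit step along \<open>d\<close> raises
  \<open>h\<close> by at least \<open>norm d\<close>. This controls the selections
  \<open>g i\<close>, which are subgradients of the positive parts.\<close>

lemma norm_subgradient_le:
  assumes "d \<in> subdifferential h x" and "\<And>y. y \<in> cball x 1 \<Longrightarrow> \<bar>h y\<bar> \<le> B"
  shows "norm d \<le> 2 * B"
proof (cases "d = 0")
  case True
  then show ?thesis using assms(2)[of x] by simp
next
  case False
  have "d \<bullet> sgn d = norm d"
    using False by (simp add: sgn_div_norm power2_norm_eq_inner[symmetric] power2_eq_square)
  moreover have "h (x + sgn d) \<ge> h x + d \<bullet> ((x + sgn d) - x)"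
    using assms(1) unfolding subdifferential_def by blast
  moreover have "\<bar>h (x + sgn d)\<bar> \<le> B" "\<bar>h x\<bar> \<le> B"
    by (auto intro!: assms(2) simp: dist_norm norm_sgn)
  ultimately show ?thesis by simp
qed

lemma norm_matrix_vector_mult_le:
  fixes C :: "real^'n^'m"
  assumes "norm v \<le> R"
  shows "norm (C *v v) \<le> onorm ((*v) C) * R"
proof -
  have "bounded_linear ((*v) C)" by (rule matrix_vector_mul_bounded_linear)
  then have "norm (C *v v) \<le> onorm ((*v) C) * norm v" "0 \<le> onorm ((*v) C)"
    by (auto intro: onorm onorm_pos_le)
  then show ?thesis using assms by (meson mult_left_mono order_trans)
qed

lemma G_map_bounded:
  assumes subgr: "\<And>S. compact S \<Longrightarrow> bounded (\<Union>x\<in>S. subdifferential f0 x)"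
    and vals: "\<And>S i. compact S \<Longrightarrow> bounded (f i ` S)"
    and g0: "\<And>x. g0 x \<in> subdifferential f0 x"
    and g: "\<And>i x. g i x \<in> subdifferential (\<lambda>y. F_vec f y $ i) x"
  shows "\<exists>M>0. \<forall>p. norm p \<le> R \<longrightarrow> norm (G_map f A b g0 g p) \<le> M"
proof -
  obtain B0 where B0': "\<And>d. d \<in> (\<Union>x\<in>cball 0 R. subdifferential f0 x) \<Longrightarrow> norm d \<le> B0"
    using subgr[OF compact_cball] unfolding bounded_iff by meson
  then have B0: "norm (g0 x) \<le> B0" if "norm x \<le> R" for x
    using g0[of x] that by (intro B0') auto
  \<comment> \<open>The radius \<open>R + 1\<close> leaves room for the unit ball around each point
    of norm at most \<open>R\<close>, as \<open>norm_subgradient_le\<close> demands.\<close>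
  have "\<forall>i. \<exists>B. \<forall>x\<in>cball 0 (R + 1). \<bar>f i x\<bar> \<le> B"
    using vals[OF compact_cball] unfolding bounded_iff by auto
  then obtain B where fB: "\<And>i x. norm x \<le> R + 1 \<Longrightarrow> \<bar>f i x\<bar> \<le> B i"
    by (metis mem_cball_0)
  then have B: "\<bar>F_vec f x $ i\<bar> \<le> B i" if "norm x \<le> R + 1" for i x
    using fB[OF that, of i] by (auto simp: F_vec_def)
  have gB: "norm (g i x) \<le> 2 * B i" if "norm x \<le> R" for i x
  proof (rule norm_subgradient_le[OF g])
    fix y assume "y \<in> cball x 1"
    then have "norm y \<le> R + 1"
      using that norm_triangle_sub[of y x] by (simp add: dist_norm norm_minus_commute)
    then show "\<bar>F_vec f y $ i\<bar> \<le> B i" by (rule B)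
  qed
  define M where "M = (B0 + (\<Sum>i\<in>UNIV. R * (2 * B i)) + onorm ((*v) (transpose A)) * R)
    + ((\<Sum>i\<in>UNIV. B i) + (onorm ((*v) A) * R + norm b))"
  have "norm (G_map f A b g0 g p) \<le> M" if p: "norm p \<le> R" for p
  proof -
    obtain x lam nu where p_eq: "p = (x, lam, nu)" by (metis prod_cases3)
    have x: "norm x \<le> R" and lam: "norm lam \<le> R" and nu: "norm nu \<le> R"
      using p unfolding p_eq by (meson norm_fst_le norm_snd_le order_trans)+
    have R: "0 \<le> R" using x norm_ge_zero order_trans by blast
    have "norm (\<Sum>i\<in>UNIV. lam $ i *\<^sub>R g i x) \<le> (\<Sum>i\<in>UNIV. R * (2 * B i))"
    proof (intro order_trans[OF norm_sum] sum_mono)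
      fix i
      have "\<bar>lam $ i\<bar> \<le> R" using component_le_norm_cart[of lam i] lam by simp
      then show "norm (lam $ i *\<^sub>R g i x) \<le> R * (2 * B i)"
        using gB[OF x, of i] R by (simp only: norm_scaleR real_norm_def) (intro mult_mono, auto)
    qed
    then have "norm (G_x g0 g A p)
        \<le> B0 + (\<Sum>i\<in>UNIV. R * (2 * B i)) + onorm ((*v) (transpose A)) * R"
      unfolding G_x_def p_eq using B0[OF x] norm_matrix_vector_mult_le[OF nu, of "transpose A"]
      by (auto intro!: norm_triangle_le add_mono)
    moreover have "norm (- F_vec f x) \<le> (\<Sum>i\<in>UNIV. B i)"
      using x unfolding norm_minus_cancel
      by (auto intro!: order_trans[OF norm_le_l1_cart sum_mono[OF B]])
    moreover have "norm (- (A *v x - b)) \<le> onorm ((*v) A) * R + norm b"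
      using norm_matrix_vector_mult_le[OF x, of A] norm_triangle_ineq4[of "A *v x" b]
      unfolding norm_minus_cancel by linarith
    ultimately have "norm (G_x g0 g A p) + (norm (- F_vec f x) + norm (- (A *v x - b))) \<le> M"
      unfolding M_def by (intro add_mono)
    moreover have "norm (G_map f A b g0 g p)
        \<le> norm (G_x g0 g A p) + (norm (- F_vec f x) + norm (- (A *v x - b)))"
      unfolding G_map_def p_eq prod.case
      by (meson add_left_mono norm_Pair_le order_trans)
    ultimately show ?thesis by linarith
  qed
  \<comment> \<open>The maximum with 1 makes the bound positive, also when \<open>R\<close> is
    negative.\<close>
  then have "\<forall>p. norm p \<le> R \<longrightarrow> norm (G_map f A b g0 g p) \<le> max M 1"
    by (meson max.coboundedI1)
  then show ?thesis by (intro exI[of _ "max M 1"]) auto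
qed

text \<open>One half of the saddle point property: by strong duality \<open>f0 x\<close> is the
  infimum of the Lagrangian at the optimal multipliers.\<close>

lemma primal_value_le_Lagrangian:
  assumes "primal_value f0 f A b = dual_value f0 f A b"
    and "dual_optimal f0 f A b lam nu"
    and "primal_optimal f0 f A b x"
  shows "f0 x \<le> Lagrangian f0 f A b y lam nu"
proof -
  have "ereal (f0 x) = (INF y. ereal (Lagrangian f0 f A b y lam nu))"
    using assms by (simp add: dual_optimal_def primal_optimal_def dual_function_def)
  also have "\<dots> \<le> ereal (Lagrangian f0 f A b y lam nu)"
    by (rule INF_lower) simp
  finally show ?thesis by simp
qed

text \<open>The Lagrangian is affine in the multipliers and
  \<open>sgn v \<bullet> v = norm v\<close>, also for \<open>v = 0\<close>. A unit step along each
  residual thus makes the infeasibility visible in its value.\<close>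

lemma Lagrangian_residual_step:
  assumes "lam \<in> nonneg_orthant"
  shows "lam + sgn (F_vec f x) \<in> nonneg_orthant"
    and "Lagrangian f0 f A b x (lam + sgn (F_vec f x)) (nu + sgn (A *v x - b))
      = Lagrangian f0 f A b x lam nu + (norm (F_vec f x) + norm (A *v x - b))"
proof -
  have sgn: "sgn v \<bullet> v = norm v" for v :: "real^'k"
    by (cases "v = 0") (simp_all add: sgn_div_norm power2_norm_eq_inner[symmetric] power2_eq_square)
  show "lam + sgn (F_vec f x) \<in> nonneg_orthant"
    using assms by (auto simp: nonneg_orthant_def sgn_div_norm F_vec_nonneg)
  show "Lagrangian f0 f A b x (lam + sgn (F_vec f x)) (nu + sgn (A *v x - b))
      = Lagrangian f0 f A b x lam nu + (norm (F_vec f x) + norm (A *v x - b))"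
    by (simp add: Lagrangian_def inner_add_left sgn)
qed

theorem theorem4p2:
  fixes f0 :: "real^'n \<Rightarrow> real"
    and f :: "'m::finite \<Rightarrow> real^'n \<Rightarrow> real"
    and A :: "real^'n^'l"
    and b :: "real^'l"
    and x_star :: "real^'n"
    and lam_star :: "real^'m"
    and nu_star :: "real^'l"
    and g0 :: "real^'n \<Rightarrow> real^'n"
    and g :: "'m \<Rightarrow> real^'n \<Rightarrow> real^'n"
    and z s :: "nat \<Rightarrow> (real^'n) \<times> (real^'m) \<times> (real^'l)"
    and \<beta> \<delta> :: "nat \<Rightarrow> real"
    and xhat xbar :: "nat \<Rightarrow> real^'n"
  assumes convex_f0: "convex_on UNIV f0"
    and convex_f: "\<And>i. convex_on UNIV (f i)"
    and x_star: "primal_optimal f0 f A b x_star"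
    and bounded_subgradients_f0:
      "\<And>S. compact S \<Longrightarrow> bounded (\<Union>x\<in>S. subdifferential f0 x)"
    and bounded_subgradients_f:
      "\<And>S i. compact S \<Longrightarrow> bounded (\<Union>x\<in>S. subdifferential (f i) x)"
    and bounded_values_f: "\<And>S i. compact S \<Longrightarrow> bounded (f i ` S)"
    and strong_duality: "primal_value f0 f A b = dual_value f0 f A b"
    and dual_optimal: "dual_optimal f0 f A b lam_star nu_star"
    and g0: "\<And>x. g0 x \<in> subdifferential f0 x"
    and g: "\<And>i x. g i x \<in> subdifferential (\<lambda>y. F_vec f y $ i) x"
    and dsg: "DSG_sequence (G_map f A b g0 g) z s \<beta> \<delta> xhat xbar"
    and G_nonzero: "\<And>k. G_map f A b g0 g (z k) \<noteq> 0"
  shows "\<exists>c>0. \<forall>\<epsilon>>0. \<forall>K::nat. real K \<ge> c / \<epsilon>^2 \<longrightarrow>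
    norm (F_vec f (xbar (K + 1))) + norm (A *v xbar (K + 1) - b) \<le> \<epsilon> \<and>
    ereal (f0 (xbar (K + 1))) \<le> primal_value f0 f A b + ereal \<epsilon>"
proof -

  \<comment> \<open>The recursion in normalized form and the saddle point\<close>
  let ?G = "G_map f A b g0 g" and ?L = "Lagrangian f0 f A b"
  define zs where "zs = (x_star, lam_star, nu_star)"
  define u where "u k = ?G (z k) /\<^sub>R norm (?G (z k))" for k
  define a where "a k = 1 / norm (?G (z k))" for k
  have z0: "fst (snd (z 0)) \<in> nonneg_orthant" and s0: "s 0 = 0" and xhat0: "xhat 0 = 0"
    and \<delta>0: "\<delta> 0 = 0" and \<beta>0: "\<beta> 0 = 1"
    and s_Suc: "\<And>k. s (Suc k) = s k + u k"
    and z_Suc: "\<And>k. z (Suc k) = z 0 - s (Suc k) /\<^sub>R \<beta> k"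
    and \<beta>_Suc: "\<And>k. \<beta> (Suc k) = \<beta> k + 1 / \<beta> k"
    and \<delta>_Suc: "\<And>k. \<delta> (Suc k) = \<delta> k + a k"
    and xhat_Suc: "\<And>k. xhat (Suc k) = xhat k + a k *\<^sub>R fst (z k)"
    and xbar_Suc: "\<And>k. xbar (Suc k) = xhat (Suc k) /\<^sub>R \<delta> (Suc k)"
    using dsg by (simp_all add: DSG_sequence_def u_def a_def inverse_eq_divide)
  have u: "norm (u k) = 1" for k
    using G_nonzero by (simp add: u_def)
  have a_pos: "a k > 0" for k
    using G_nonzero by (simp add: a_def)
  have \<beta>1: "\<beta> k \<ge> 1" for k
    using beta_sequence_ge_1[OF \<beta>0 \<beta>_Suc] .
  have feas: "x_star \<in> feasible_set f A b" and p: "primal_value f0 f A b = ereal (f0 x_star)"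
    using x_star by (auto simp: primal_optimal_def)
  have lam_star: "lam_star \<in> nonneg_orthant"
    using dual_optimal by (simp add: dual_optimal_def)
  have L_star: "f0 x_star \<le> ?L y lam_star nu_star" for y
    using primal_value_le_Lagrangian[OF strong_duality dual_optimal x_star] .

  have lam_s: "fst (snd (s k)) $ i \<le> 0" for k i
  proof (induction k)
    case (Suc k)
    \<comment> \<open>The multiplier block of \<open>G\<close> is minus a nonnegative vector, so
      subtracting the accumulated \<open>s\<close> only raises the initial multipliers and no
      projection occurs.\<close>
    have "fst (snd (?G (z k))) $ i \<le> 0"
      by (simp add: G_map_def split_beta F_vec_nonneg)
    then have "fst (snd (u k)) $ i \<le> 0"
      by (simp add: u_def mult_nonneg_nonpos)
    then show ?case using Suc by (simp add: s_Suc)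
  qed (simp add: s0)
  have lam_z: "fst (snd (z k)) \<in> nonneg_orthant" for k
  proof (cases k)
    case (Suc j)
    have "inverse (\<beta> j) * fst (snd (s (Suc j))) $ i \<le> 0" for i
      using \<beta>1[of j] lam_s[of "Suc j" i] by (intro mult_nonneg_nonpos) auto
    then show ?thesis
      using z0 unfolding Suc z_Suc[of j] nonneg_orthant_def
      by (auto intro: order_trans[of _ 0])
  qed (simp add: z0)

  have regret: "(\<Sum>i\<le>k. u i \<bullet> (z i - w)) + \<beta> k / 2 * (norm (z (Suc k) - w))\<^sup>2
      \<le> \<beta> k / 2 * (1 + (norm (z 0 - w))\<^sup>2)" for k w
    using dual_averaging_regret[OF s0 s_Suc u z_Suc \<beta>0 \<beta>_Suc] .
  \<comment> \<open>The comparison multipliers stay free: the optimal ones confine the iterates,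
    others give the two final bounds.\<close>
  have gap: "a k * (?L (fst (z k)) lam nu - f0 x_star) \<le> u k \<bullet> (z k - (x_star, lam, nu))" for k lam nu
  proof -
    have "?L (fst (z k)) lam nu - f0 x_star \<le> ?G (z k) \<bullet> (z k - (x_star, lam, nu))"
      using Lagrangian_gap_le_G_map_inner[where x = "fst (z k)" and lam = "fst (snd (z k))"
          and nu = "snd (snd (z k))" and ?g0.0 = g0 and g = g and f = f and A = A and b = b
          and ?f0.0 = f0 and x' = x_star and lam' = lam and nu' = nu, OF g0 g lam_z]
      by (simp only: Lagrangian_at_feasible[OF feas] prod.collapse)
    then show ?thesis
      by (simp add: u_def a_def inverse_eq_divide divide_right_mono)
  qed

  \<comment> \<open>Boundedness of the iterates and of \<open>G\<close> along them\<close>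
  have z_near: "norm (z k - zs) \<le> 1 + norm (z 0 - zs)" for k
  proof (cases k)
    case (Suc j)
    have "0 \<le> u i \<bullet> (z i - zs)" for i
      unfolding zs_def using L_star[of "fst (z i)"] a_pos[of i]
      by (intro order_trans[OF _ gap] mult_nonneg_nonneg) auto
    then have "\<beta> j / 2 * (norm (z (Suc j) - zs))\<^sup>2 \<le> \<beta> j / 2 * (1 + (norm (z 0 - zs))\<^sup>2)"
      using regret[where k = j and w = zs] sum_nonneg[of "{..j}" "\<lambda>i. u i \<bullet> (z i - zs)"] by simp
    then have "(norm (z (Suc j) - zs))\<^sup>2 \<le> 1 + (norm (z 0 - zs))\<^sup>2"
      using \<beta>1[of j] by (simp add: mult_le_cancel_left)
    also have "\<dots> \<le> (1 + norm (z 0 - zs))\<^sup>2"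
      by (simp add: power2_sum)
    finally show ?thesis
      unfolding Suc by (rule power2_le_imp_le) simp
  qed simp
  obtain M where M: "M > 0" and GM: "\<And>k. norm (?G (z k)) \<le> M"
  proof -
    have "norm (z k) \<le> norm zs + (1 + norm (z 0 - zs))" for k
      using z_near[of k] norm_triangle_sub[of "z k" zs] by linarith
    then show ?thesis
      using G_map_bounded[OF bounded_subgradients_f0 bounded_values_f g0 g,
          of "norm zs + (1 + norm (z 0 - zs))" A b] that by blast
  qed

  \<comment> \<open>The averaging weights and the convergence rate\<close>
  have \<delta>: "\<delta> (Suc k) = (\<Sum>i\<le>k. a i)" for k
    by (induction k) (simp_all add: \<delta>0 \<delta>_Suc)
  have xhat: "xhat (Suc k) = (\<Sum>i\<le>k. a i *\<^sub>R fst (z i))" for k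
    by (induction k) (simp_all add: xhat0 xhat_Suc)
  have \<delta>_ge: "\<delta> (Suc k) \<ge> real (Suc k) / M" for k
  proof -
    have "1 / M \<le> a i" for i
      unfolding a_def using GM[of i] G_nonzero[of i] by (intro divide_left_mono) (auto simp: M)
    then have "(\<Sum>i\<le>k. 1 / M) \<le> \<delta> (Suc k)"
      unfolding \<delta> by (rule sum_mono)
    then show ?thesis by simp
  qed

  \<comment> \<open>The bound \<open>D\<close> on the distance to the comparison point stands in for
    the multipliers, which may then depend on \<open>k\<close>.\<close>
  have rate: "?L (xbar (Suc k)) lam nu - f0 x_star \<le> M * D / sqrt (real (Suc k))"
    if lam: "lam \<in> nonneg_orthant" and D: "1 + (norm (z 0 - (x_star, lam, nu)))\<^sup>2 \<le> D" for k lam nu D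
  proof -
    let ?w = "(x_star, lam, nu)"
    have \<delta>_pos: "\<delta> (Suc k) > 0"
      by (rule less_le_trans[OF _ \<delta>_ge]) (simp add: M)
    have D0: "D \<ge> 0" using D by (smt (verit) zero_le_power2)
    \<comment> \<open>Jensen's inequality: the weights \<open>a i / \<delta> (Suc k)\<close> are
      nonnegative and sum to 1.\<close>
    have "?L (\<Sum>i\<le>k. (a i / \<delta> (Suc k)) *\<^sub>R fst (z i)) lam nu
        \<le> (\<Sum>i\<le>k. (a i / \<delta> (Suc k)) * ?L (fst (z i)) lam nu)"
      using \<delta>_pos a_pos
      by (intro convex_on_sum[OF _ _ convex_on_Lagrangian[OF convex_f0 convex_f lam]])
        (auto simp: sum_divide_distrib[symmetric] \<delta>[symmetric] less_imp_le)
    moreover have "xbar (Suc k) = (\<Sum>i\<le>k. (a i / \<delta> (Suc k)) *\<^sub>R fst (z i))"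
      by (simp add: xbar_Suc xhat scaleR_sum_right divide_inverse_commute)
    moreover have "(\<Sum>i\<le>k. (a i / \<delta> (Suc k)) * ?L (fst (z i)) lam nu)
        = (\<Sum>i\<le>k. a i * (?L (fst (z i)) lam nu - f0 x_star)) / \<delta> (Suc k) + f0 x_star"
      using \<delta>_pos by (simp add: right_diff_distrib sum_subtractf sum_distrib_right[symmetric]
          \<delta>[symmetric] diff_divide_distrib sum_divide_distrib)
    moreover have "(\<Sum>i\<le>k. a i * (?L (fst (z i)) lam nu - f0 x_star)) \<le> \<beta> k / 2 * D"
    proof -
      have "(\<Sum>i\<le>k. a i * (?L (fst (z i)) lam nu - f0 x_star)) \<le> (\<Sum>i\<le>k. u i \<bullet> (z i - ?w))"
        by (intro sum_mono gap)
      also have "\<dots> \<le> \<beta> k / 2 * (1 + (norm (z 0 - ?w))\<^sup>2)"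
      proof -
        have "0 \<le> \<beta> k / 2 * (norm (z (Suc k) - ?w))\<^sup>2"
          using \<beta>1[of k] by simp
        then show ?thesis using regret[where k = k and w = ?w] by linarith
      qed
      also have "\<dots> \<le> \<beta> k / 2 * D"
        using D \<beta>1[of k] by (intro mult_left_mono) auto
      finally show ?thesis .
    qed
    ultimately have "?L (xbar (Suc k)) lam nu - f0 x_star \<le> (\<beta> k / 2 * D) / \<delta> (Suc k)"
      using divide_right_mono[of _ "\<beta> k / 2 * D" "\<delta> (Suc k)"] \<delta>_pos by fastforce
    also have "\<dots> \<le> (sqrt (real (Suc k)) * D) / (real (Suc k) / M)"
    proof (intro frac_le mult_right_mono \<delta>_ge D0)
      \<comment> \<open>The factor \<open>sqrt 3\<close> from the growth of \<open>\<beta>\<close>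
        is at most 2 and is absorbed by the half.\<close>
      have "sqrt (3 * real (Suc k)) \<le> 2 * sqrt (real (Suc k))"
        unfolding real_sqrt_mult by (intro mult_right_mono real_le_lsqrt) auto
      then show "\<beta> k / 2 \<le> sqrt (real (Suc k))"
        using beta_sequence_sqrt_bound[OF \<beta>0 \<beta>_Suc, of k] by linarith
    qed (use D0 M in auto)
    also have "\<dots> = M * D * (sqrt (real (Suc k)) / real (Suc k))"
      by simp
    also have "sqrt (real (Suc k)) / real (Suc k) = 1 / sqrt (real (Suc k))"
      by (simp add: sqrt_divide_self_eq inverse_eq_divide del: of_nat_Suc)
    finally show ?thesis by simp
  qed

  \<comment> \<open>The first entry serves the zero multipliers; the second serves the optimal ones
    shifted by two vectors of norm at most 1, hence by at most 2.\<close>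
  define D where
    "D = max (1 + (norm (z 0 - (x_star, 0, 0)))\<^sup>2) (1 + (norm (z 0 - zs) + 2)\<^sup>2)"
  have D0: "D > 0"
    unfolding D_def by (simp add: less_max_iff_disj add_pos_nonneg)
  have objective: "f0 (xbar (Suc k)) - f0 x_star \<le> M * D / sqrt (real (Suc k))" for k
    using rate[of 0 0 D k] by (simp add: nonneg_orthant_def D_def Lagrangian_def)
  \<comment> \<open>The shifted multipliers depend on the average itself. The rate bounds Lagrangian
    gap plus infeasibility, and \<open>L_star\<close> makes the gap at the optimal multipliers
    nonnegative.\<close>
  have infeasibility: "norm (F_vec f (xbar (Suc k))) + norm (A *v xbar (Suc k) - b)
      \<le> M * D / sqrt (real (Suc k))" for k
  proof -
    let ?x = "xbar (Suc k)"
    let ?d = "(0, sgn (F_vec f ?x), sgn (A *v ?x - b))"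
    have "norm ?d \<le> 2"
      using norm_Pair_le[of "sgn (F_vec f ?x)" "sgn (A *v ?x - b)"]
      by (auto simp: norm_Pair norm_sgn split: if_splits)
    moreover have "(x_star, lam_star + sgn (F_vec f ?x), nu_star + sgn (A *v ?x - b)) = zs + ?d"
      by (simp add: zs_def)
    ultimately have "norm (z 0 - (x_star, lam_star + sgn (F_vec f ?x), nu_star + sgn (A *v ?x - b)))
        \<le> norm (z 0 - zs) + 2"
      using norm_triangle_ineq4[of "z 0 - zs" ?d] by (simp add: diff_diff_add)
    then have "1 + (norm (z 0 - (x_star, lam_star + sgn (F_vec f ?x), nu_star + sgn (A *v ?x - b))))\<^sup>2
        \<le> D"
      unfolding D_def by (intro max.coboundedI2 add_left_mono power_mono) auto
    from rate[OF Lagrangian_residual_step(1)[OF lam_star] this, of k]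
    show ?thesis
      using L_star[of ?x] unfolding Lagrangian_residual_step(2)[OF lam_star] by linarith
  qed

  \<comment> \<open>This fixes the constant \<open>c = (M * D)\<^sup>2\<close>. The average with
    index \<open>Suc K\<close> uses \<open>K + 1\<close> iterates, so the bound on \<open>K\<close>
    is more than enough.\<close>
  have small: "M * D / sqrt (real (Suc K)) \<le> \<epsilon>" if \<epsilon>: "\<epsilon> > 0" and K: "real K \<ge> (M * D)\<^sup>2 / \<epsilon>\<^sup>2" for \<epsilon> K
  proof -
    have "(M * D / \<epsilon>)\<^sup>2 \<le> real (Suc K)"
      using K by (simp add: power_divide)
    then have "M * D / \<epsilon> \<le> sqrt (real (Suc K))"
      by (rule real_le_rsqrt)
    then show ?thesis
      using \<epsilon> by (simp add: field_simps del: of_nat_Suc)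
  qed
  show ?thesis
  proof (intro exI[of _ "(M * D)\<^sup>2"] conjI allI impI)
    show "(M * D)\<^sup>2 > 0" using M D0 by simp
  next
    fix \<epsilon> :: real and K :: nat
    assume *: "\<epsilon> > 0" "real K \<ge> (M * D)\<^sup>2 / \<epsilon>\<^sup>2"
    show "norm (F_vec f (xbar (K + 1))) + norm (A *v xbar (K + 1) - b) \<le> \<epsilon>"
      using infeasibility[of K] small[OF *] by simp
    show "ereal (f0 (xbar (K + 1))) \<le> primal_value f0 f A b + ereal \<epsilon>"
      using objective[of K] small[OF *] by (simp add: p)
  qed
qed

end
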